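(* Assume that the exosystem generates admissible reference signals. If the state feedback regulation problem (SFRP) is solved by some control law $u(t)=Kz(t)+Lw(t)$, with $K\in\mathcal{L}(Z,U)$ and $L\in\mathcal{L}(W,U)$, such that the operator $BL+P\in\mathcal{L}(W,Z)$ is conform for the semigroup $T_{A+BK}(t)$, then there exist $\Pi\in\mathcal{L}(W,Z)$ and $\Gamma\in\mathcal{L}(W,U)$ such that $\Pi(D(S))\subset D(A)$, $L=\Gamma-K\Pi$, and the regulator equations $$A\Pi+B\Gamma+P=\Pi S\ \text{ in } D(S),\qquad C\Pi=Q\ \text{ in } W$$ are satisfied.
   Context: Setting. $Z,U,Y,W$ are complex Banach spaces. The plant is $\dot z(t)=Az(t)+Bu(t)+\mathcal{U}_d(t)$, $y(t)=Cz(t)$, $t\ge 0$, $z(0)=z_0\in Z$, where $A$ generates a $C_0$-semigroup $T_A(t)$ on $Z$, $B\in\mathcal{L}(U,Z)$, $C\in\mathcal{L}(Z,Y)$. The exosystem is $\dot w(t)=Sw(t)$, $y_r(t)=Qw(t)$, $\mathcal{U}_d(t)=Pw(t)$, $t\in\mathbb{R}$, $w(0)=w_0\in W$, where $S$ generates an isometric $C_0$-group $T_S(t)$, $t\in\mathbb{R}$, on $W$, $P\in\mathcal{L}(W,Z)$, $Q\in\mathcal{L}(W,Y)$. Solutions are mild solutions. The tracking error is $e(t)=y(t)-y_r(t)=Cz(t)-Qw(t)$. Polynomial stability. A $C_0$-semigroup $T(t)$ on $Z$ with generator $G$ is polynomially stable if there are constants $\alpha,\beta,N>0$ with $\|T(t)G_\mu^{-\alpha}\|\le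 N t^{-\beta}$ for all $t>0$, where $G_\mu=\mu I-G$ and $\mu$ is a fixed real number with $\|T(t)\|\le Me^{(\mu-\varepsilon)t}$ for some $M,\varepsilon>0$ and all $t\ge 0$ (the notion does not depend on $\mu$). It is bounded if $\sup_{t\ge0}\|T(t)\|<\infty$. For a bounded polynomially stable semigroup, $\sigma(G)\subset\{\mathrm{Re}\,\lambda<0\}$ and there are $\alpha,N>0$ with $\|T(t)(-G)^{-\alpha}\|\le N/t$ for all $t>0$, equivalently (with a possibly different $N$) $\|T(t)G^{-1}\|\le N t^{-1/\alpha}$ for all $t>0$. SFRP. A control law $u(t)=Kz(t)+Lw(t)$, with $K\in\mathcal{L}(Z,U)$ and $L\in\mathcal{L}(W,U)$, solves the SFRP if: (i) $A+BK$ generates a bounded polynomially stable $C_0$-semigroup $T_{A+BK}(t)$ on $Z$; (ii) for the extended closed loop system $\dot z(t)=(A+BK)z(t)+(BL+P)w(t)$, $\dot w(t)=Sw(t)$, $t\ge0$, the tracking error $e(t)=Cz(t)-Qw(t)$ tends to $0$ as $t\to\infty$ for all initial conditions $z_0\in Z$, $w_0\in W$, and for all $z_0\in D(A)$, $w_0\in D(S)$ there is $m>0$ (depending on the initial conditions) with $\|e(t)\|_Y\le m\,t^{-1/\alpha}$ for all $t>0$, where $\alpha$ is the exponent above for $G=A+BK$. Conform operator. For a polynomially stable $C_0$-semigroup $T(t)$ on $Z$, an operator $\Delta\in\mathcal{L}(W,Z)$ is conform for $T(t)$ if $w\mapsto\int_0^\infty T(t)\Delta T_S(-t)w\,dt$,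 $w\in D(S)$ (improper integral), defines a linear bounded operator from $D(S)$ to $Z$, where $D(S)$ is endowed with the norm induced by $W$. Admissible reference signals. $C_0^+(\mathbb{R},Y)$ is the space of bounded uniformly continuous functions $f:\mathbb{R}\to Y$ with $\lim_{t\to+\infty}f(t)=0$. The exosystem generates admissible reference signals if for every $w\in W$ and every $R\in\mathcal{L}(W,Y)$: $RT_S(\cdot)w\in C_0^+(\mathbb{R},Y)$ only if $Rw=0$. *)

theory Defs
  imports "HOL-Analysis.Analysis"
begin

section \<open>Complex Banach spaces and bounded operators\<close>

text \<open>The libraries only provide real Banach spaces, so a compatible complex scalar
  multiplication is added to \<^class>\<open>banach\<close>.\<close>

class complex_banach = banach +
  fixes scaleC :: "complex \<Rightarrow> 'a \<Rightarrow> 'a" (infixr "*\<^sub>C" 75)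
  assumes scaleC_add_right: "a *\<^sub>C (x + y) = a *\<^sub>C x + a *\<^sub>C y"
    and scaleC_add_left: "(a + b) *\<^sub>C x = a *\<^sub>C x + b *\<^sub>C x"
    and scaleC_scaleC: "a *\<^sub>C (b *\<^sub>C x) = (a * b) *\<^sub>C x"
    and scaleR_scaleC: "r *\<^sub>R x = complex_of_real r *\<^sub>C x"
    and norm_scaleC: "norm (a *\<^sub>C x) = cmod a * norm x"

instantiation complex :: complex_banach
begin

definition scaleC_complex :: "complex \<Rightarrow> complex \<Rightarrow> complex"
  where "scaleC_complex a x = a * x"

instance
  by standard (simp_all add: scaleC_complex_def algebra_simps norm_mult scaleR_conv_of_real)

end

definition bounded_clinear :: "('a::complex_banach \<Rightarrow> 'b::complex_banach) \<Rightarrow> bool"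
  where "bounded_clinear f \<longleftrightarrow> bounded_linear f \<and> (\<forall>c x. f (c *\<^sub>C x) = c *\<^sub>C f x)"

text \<open>Bounded linear operators on a subspace \<open>D\<close> carrying the norm of the ambient space.\<close>

definition bounded_clinear_on ::
    "'a::complex_banach set \<Rightarrow> ('a \<Rightarrow> 'b::complex_banach) \<Rightarrow> bool"
  where "bounded_clinear_on D f \<longleftrightarrow>
    (\<forall>x\<in>D. \<forall>y\<in>D. f (x + y) = f x + f y) \<and>
    (\<forall>c. \<forall>x\<in>D. f (c *\<^sub>C x) = c *\<^sub>C f x) \<and>
    (\<exists>M. \<forall>x\<in>D. norm (f x) \<le> M * norm x)"


section \<open>Semigroups, groups and generators\<close>

text \<open>A one-parameter semigroup is a function on \<open>real\<close> of which only the values at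
  \<open>t \<ge> 0\<close> matter.  An unbounded operator is a pair of a domain \<open>D\<close> and a function \<open>G\<close>;
  the values of \<open>G\<close> outside \<open>D\<close> are irrelevant.\<close>

definition C0_semigroup :: "(real \<Rightarrow> 'a::complex_banach \<Rightarrow> 'a) \<Rightarrow> bool"
  where "C0_semigroup T \<longleftrightarrow>
    (\<forall>t\<ge>0. bounded_clinear (T t)) \<and>
    (\<forall>x. T 0 x = x) \<and>
    (\<forall>s\<ge>0. \<forall>t\<ge>0. \<forall>x. T (s + t) x = T s (T t x)) \<and>
    (\<forall>x. ((\<lambda>t. T t x) \<longlongrightarrow> x) (at_right 0))"

definition generates_C0_semigroup ::
    "'a::complex_banach set \<Rightarrow> ('a \<Rightarrow> 'a) \<Rightarrow> (real \<Rightarrow> 'a \<Rightarrow> 'a) \<Rightarrow> bool"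
  where "generates_C0_semigroup D G T \<longleftrightarrow> C0_semigroup T \<and>
    (\<forall>x y. (x \<in> D \<and> G x = y) \<longleftrightarrow> ((\<lambda>h. (T h x - x) /\<^sub>R h) \<longlongrightarrow> y) (at_right 0))"

definition isometric_C0_group :: "(real \<Rightarrow> 'a::complex_banach \<Rightarrow> 'a) \<Rightarrow> bool"
  where "isometric_C0_group T \<longleftrightarrow>
    (\<forall>t. bounded_clinear (T t)) \<and>
    (\<forall>x. T 0 x = x) \<and>
    (\<forall>s t x. T (s + t) x = T s (T t x)) \<and>
    (\<forall>x. ((\<lambda>t. T t x) \<longlongrightarrow> x) (at 0)) \<and>
    (\<forall>t x. norm (T t x) = norm x)"

definition generates_isometric_C0_group ::
    "'a::complex_banach set \<Rightarrow> ('a \<Rightarrow> 'a) \<Rightarrow> (real \<Rightarrow> 'a \<Rightarrow> 'a) \<Rightarrow> bool"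
  where "generates_isometric_C0_group D G T \<longleftrightarrow> isometric_C0_group T \<and>
    (\<forall>x y. (x \<in> D \<and> G x = y) \<longleftrightarrow> ((\<lambda>h. (T h x - x) /\<^sub>R h) \<longlongrightarrow> y) (at 0))"

definition bounded_semigroup :: "(real \<Rightarrow> 'a::complex_banach \<Rightarrow> 'a) \<Rightarrow> bool"
  where "bounded_semigroup T \<longleftrightarrow> (\<exists>M. \<forall>t\<ge>0. onorm (T t) \<le> M)"


section \<open>Fractional powers and polynomial stability\<close>

text \<open>The resolvent \<open>(cI - G)\<^sup>-\<^sup>1\<close>; meaningful when \<open>c\<close> lies in the resolvent set of \<open>G\<close>.\<close>

definition resolvent ::
    "'a::complex_banach set \<Rightarrow> ('a \<Rightarrow> 'a) \<Rightarrow> complex \<Rightarrow> 'a \<Rightarrow> 'a"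
  where "resolvent D G c = inv_into D (\<lambda>x. c *\<^sub>C x - G x)"

text \<open>\<open>neg_frac_power D G \<mu> \<alpha>\<close> is the negative fractional power \<open>(\<mu>I - G)\<^sup>-\<^sup>\<alpha>\<close>, given by the
  Balakrishnan--Komatsu formula: for \<open>0 < \<alpha> < m\<close> with \<open>m\<close> an integer,
  \<open>(\<mu>I - G)\<^sup>-\<^sup>\<alpha> = 1 / B(\<alpha>, m - \<alpha>) \<integral>\<^sub>0\<^sup>\<infinity> s\<^sup>m\<^sup>-\<^sup>\<alpha>\<^sup>-\<^sup>1 (sI + (\<mu>I - G))\<^sup>-\<^sup>m ds\<close>,
  where \<open>B\<close> is the Beta function (for scalars, substitute \<open>s = (\<mu> - G) u\<close>).  The value does
  not depend on \<open>m\<close>; the least \<open>m > \<alpha>\<close> is used.  The integral converges absolutely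
  when \<open>G\<close> generates a \<open>C\<^sub>0\<close>-semigroup \<open>T\<close> with \<open>\<parallel>T t\<parallel> \<le> M exp ((\<mu> - \<epsilon>) t)\<close>, \<open>\<epsilon> > 0\<close>, and,
  in the case \<open>\<mu> = 0\<close>, when \<open>T\<close> is bounded and \<open>0\<close> is in the resolvent set of \<open>G\<close>.\<close>

definition neg_frac_power ::
    "'a::complex_banach set \<Rightarrow> ('a \<Rightarrow> 'a) \<Rightarrow> real \<Rightarrow> real \<Rightarrow> 'a \<Rightarrow> 'a"
  where "neg_frac_power D G \<mu> \<alpha> x =
    (let m = nat \<lfloor>\<alpha>\<rfloor> + 1 in
      integral {0..} (\<lambda>s. (s powr (real m - \<alpha> - 1)) *\<^sub>R
          (resolvent D G (complex_of_real (s + \<mu>)) ^^ m) x) /\<^sub>R Beta \<alpha> (real m - \<alpha>))"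

text \<open>The notion does not depend on the choice of \<open>\<mu>\<close> above the growth bound, so \<open>\<mu>\<close> is
  quantified existentially.\<close>

definition polynomially_stable ::
    "'a::complex_banach set \<Rightarrow> ('a \<Rightarrow> 'a) \<Rightarrow> (real \<Rightarrow> 'a \<Rightarrow> 'a) \<Rightarrow> bool"
  where "polynomially_stable D G T \<longleftrightarrow>
    generates_C0_semigroup D G T \<and>
    (\<exists>\<mu> M \<epsilon>. M > 0 \<and> \<epsilon> > 0 \<and> (\<forall>t\<ge>0. onorm (T t) \<le> M * exp ((\<mu> - \<epsilon>) * t)) \<and>
      (\<exists>\<alpha> \<beta> N. \<alpha> > 0 \<and> \<beta> > 0 \<and> N > 0 \<and>
        (\<forall>t>0. onorm (\<lambda>x. T t (neg_frac_power D G \<mu> \<alpha> x)) \<le> N * t powr (- \<beta>))))"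

text \<open>\<open>\<alpha>\<close> is an exponent with \<open>\<parallel>T(t) (-G)\<^sup>-\<^sup>\<alpha>\<parallel> = O(1/t)\<close>; intended for bounded
  polynomially stable \<open>T\<close>, for which the closed right half-plane is in the resolvent set.\<close>

definition stability_exponent ::
    "'a::complex_banach set \<Rightarrow> ('a \<Rightarrow> 'a) \<Rightarrow> (real \<Rightarrow> 'a \<Rightarrow> 'a) \<Rightarrow> real \<Rightarrow> bool"
  where "stability_exponent D G T \<alpha> \<longleftrightarrow> \<alpha> > 0 \<and>
    (\<exists>N>0. \<forall>t>0. onorm (\<lambda>x. T t (neg_frac_power D G 0 \<alpha> x)) \<le> N / t)"


section \<open>The state feedback regulation problem\<close>

text \<open>Mild solution of \<open>z' = G z + f\<close>, \<open>z 0 = z0\<close>, where \<open>G\<close> generates \<open>T\<close>.\<close>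

definition mild_solution ::
    "(real \<Rightarrow> 'z::complex_banach \<Rightarrow> 'z) \<Rightarrow> (real \<Rightarrow> 'z) \<Rightarrow> 'z \<Rightarrow> real \<Rightarrow> 'z"
  where "mild_solution T f z0 t = T t z0 + integral {0..t} (\<lambda>s. T (t - s) (f s))"

text \<open>The tracking error \<open>C z(t) - Q w(t)\<close> for \<open>z' = G z + \<Delta> w\<close>, \<open>w' = S w\<close>, where \<open>T\<close> is
  generated by \<open>G\<close> and \<open>TS\<close> by \<open>S\<close>.\<close>

definition tracking_error ::
    "(real \<Rightarrow> 'z::complex_banach \<Rightarrow> 'z) \<Rightarrow> (real \<Rightarrow> 'w::complex_banach \<Rightarrow> 'w) \<Rightarrow> ('w \<Rightarrow> 'z) \<Rightarrow>
     ('z \<Rightarrow> 'y::complex_banach) \<Rightarrow> ('w \<Rightarrow> 'y) \<Rightarrow> 'z \<Rightarrow> 'w \<Rightarrow> real \<Rightarrow> 'y"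
  where "tracking_error T TS \<Delta> C Q z0 w0 t =
    C (mild_solution T (\<lambda>s. \<Delta> (TS s w0)) z0 t) - Q (TS t w0)"

text \<open>The control law \<open>u = K z + L w\<close> solves the SFRP; \<open>T\<close> is the closed loop semigroup
  \<open>T\<^sub>A\<^sub>+\<^sub>B\<^sub>K\<close>, which (on \<open>t \<ge> 0\<close>) is determined by its generator \<open>A + BK\<close> with domain
  \<open>D(A)\<close>.\<close>

definition solves_SFRP ::
    "'z::complex_banach set \<Rightarrow> ('z \<Rightarrow> 'z) \<Rightarrow> ('u::complex_banach \<Rightarrow> 'z) \<Rightarrow>
     ('z \<Rightarrow> 'y::complex_banach) \<Rightarrow> 'w::complex_banach set \<Rightarrow> (real \<Rightarrow> 'w \<Rightarrow> 'w) \<Rightarrow>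
     ('w \<Rightarrow> 'z) \<Rightarrow> ('w \<Rightarrow> 'y) \<Rightarrow> ('z \<Rightarrow> 'u) \<Rightarrow> ('w \<Rightarrow> 'u) \<Rightarrow> (real \<Rightarrow> 'z \<Rightarrow> 'z) \<Rightarrow> bool"
  where "solves_SFRP DA A B C DS TS P Q K L T \<longleftrightarrow>
    bounded_clinear K \<and> bounded_clinear L \<and>
    generates_C0_semigroup DA (\<lambda>z. A z + B (K z)) T \<and>
    bounded_semigroup T \<and>
    polynomially_stable DA (\<lambda>z. A z + B (K z)) T \<and>
    (\<forall>z0 w0. (tracking_error T TS (\<lambda>w. B (L w) + P w) C Q z0 w0 \<longlongrightarrow> 0) at_top) \<and>
    (\<exists>\<alpha>. stability_exponent DA (\<lambda>z. A z + B (K z)) T \<alpha> \<and>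
      (\<forall>z0\<in>DA. \<forall>w0\<in>DS. \<exists>m>0. \<forall>t>0.
        norm (tracking_error T TS (\<lambda>w. B (L w) + P w) C Q z0 w0 t) \<le> m * t powr (- 1 / \<alpha>)))"

definition conform ::
    "(real \<Rightarrow> 'z::complex_banach \<Rightarrow> 'z) \<Rightarrow> 'w::complex_banach set \<Rightarrow> (real \<Rightarrow> 'w \<Rightarrow> 'w) \<Rightarrow>
     ('w \<Rightarrow> 'z) \<Rightarrow> bool"
  where "conform T DS TS \<Delta> \<longleftrightarrow> bounded_clinear \<Delta> \<and>
    (\<exists>F. bounded_clinear_on DS F \<and>
      (\<forall>w\<in>DS. ((\<lambda>\<tau>. integral {0..\<tau>} (\<lambda>t. T t (\<Delta> (TS (- t) w)))) \<longlongrightarrow> F w) at_top))"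

definition C0_plus :: "(real \<Rightarrow> 'y::complex_banach) set"
  where "C0_plus =
    {f. bounded (range f) \<and> uniformly_continuous_on UNIV f \<and> (f \<longlongrightarrow> 0) at_top}"

text \<open>The type argument fixes the output space \<open>Y\<close>, over which \<open>R\<close> ranges.\<close>

definition generates_admissible_signals ::
    "(real \<Rightarrow> 'w::complex_banach \<Rightarrow> 'w) \<Rightarrow> 'y::complex_banach itself \<Rightarrow> bool"
  where "generates_admissible_signals TS Y \<longleftrightarrow>
    (\<forall>w. \<forall>R::'w \<Rightarrow> 'y. bounded_clinear R \<longrightarrow> (\<lambda>t. R (TS t w)) \<in> C0_plus \<longrightarrow> R w = 0)"

end

theory Submission
  imports Defs
begin

text \<open>Write \<open>G = A + BK\<close>, \<open>\<Delta> = BL + P\<close> and let \<open>T\<close> be the closed loop semigroup.  The operator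
  \<open>\<Pi>\<close> is given on \<open>D(S)\<close> by \<open>\<Pi> w = \<integral>\<^sub>0\<^sup>\<infinity> T(t) \<Delta> T\<^sub>S(-t) w dt\<close>, which exists and is bounded
  because \<open>\<Delta>\<close> is conform, and it extends to \<open>W\<close> since \<open>D(S)\<close> is dense
  (\<open>domain_dense\<close>, \<open>bounded_clinear_extension\<close>).

  Everything follows from one identity (\<open>conform_integral_orbit\<close>).  Applying \<open>T(h)\<close> to the
  integral shifts it, so that for \<open>w \<in> D(S)\<close> and \<open>h \<ge> 0\<close>
  \<open>\<Pi> T\<^sub>S(h) w = T(h) \<Pi> w + \<integral>\<^sub>0\<^sup>h T(h - s) \<Delta> T\<^sub>S(s) w ds\<close>.
  In other words, the mild solution of the closed loop that starts in \<open>\<Pi> w\<close> stays on the graph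
  of \<open>\<Pi>\<close>.  Two readings of the identity give the two regulator equations.

  Infinitesimally, dividing by \<open>h\<close> and letting \<open>h\<close> tend to \<open>0\<close> shows that \<open>\<Pi> w\<close> lies in the
  domain of \<open>G\<close> and \<open>G \<Pi> w = \<Pi> S w - \<Delta> w\<close>; with \<open>\<Gamma> = L + K \<Pi>\<close> this is the first equation.

  Asymptotically, the tracking error along this solution is \<open>R T\<^sub>S(t) w\<close> with
  \<open>R = C \<Pi> - Q\<close>.  It tends to \<open>0\<close> because the control law solves the regulation problem, and it
  is bounded and uniformly continuous on the whole line because \<open>T\<^sub>S\<close> is isometric.
  Admissibility of the reference signals therefore yields \<open>R w = 0\<close>, first on \<open>D(S)\<close> and then
  by density on \<open>W\<close>.\<close>

section \<open>Bounded complex linear operators\<close>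

lemma bounded_clinear_imp_bounded_linear: "bounded_clinear f \<Longrightarrow> bounded_linear f"
  by (simp add: bounded_clinear_def)

lemma bounded_linear_scaleC: "bounded_linear (\<lambda>x::'a::complex_banach. c *\<^sub>C x)"
proof (rule bounded_linear_intro[where K = "cmod c"])
  show "c *\<^sub>C (x + y) = c *\<^sub>C x + c *\<^sub>C y" for x y :: 'a
    by (rule scaleC_add_right)
  show "c *\<^sub>C (r *\<^sub>R x) = r *\<^sub>R (c *\<^sub>C x)" for r and x :: 'a
    by (simp add: scaleR_scaleC scaleC_scaleC mult.commute)
  show "norm (c *\<^sub>C x) \<le> norm x * cmod c" for x :: 'a
    by (simp add: norm_scaleC mult.commute)
qed

lemma bounded_clinear_compose:
  "bounded_clinear f \<Longrightarrow> bounded_clinear g \<Longrightarrow> bounded_clinear (\<lambda>x. f (g x))"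
  by (auto simp: bounded_clinear_def intro: bounded_linear_compose)

lemma bounded_clinear_add:
  "bounded_clinear f \<Longrightarrow> bounded_clinear g \<Longrightarrow> bounded_clinear (\<lambda>x. f x + g x)"
  by (auto simp: bounded_clinear_def scaleC_add_right intro: bounded_linear_add)

lemma bounded_clinear_diff:
  "bounded_clinear f \<Longrightarrow> bounded_clinear g \<Longrightarrow> bounded_clinear (\<lambda>x. f x - g x)"
  by (auto simp: bounded_clinear_def linear_diff[OF bounded_linear.linear[OF bounded_linear_scaleC]]
      intro: bounded_linear_sub)

text \<open>The bound makes the operator uniformly continuous, so it has a continuous extension; the
  algebraic identities and the bound pass to limits along the dense subspace.\<close>

lemma bounded_clinear_extension:
  fixes F :: "'a::complex_banach \<Rightarrow> 'b::complex_banach"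
  assumes dense: "closure D = UNIV"
    and add: "\<And>x y. x \<in> D \<Longrightarrow> y \<in> D \<Longrightarrow> x + y \<in> D"
    and scale: "\<And>c x. x \<in> D \<Longrightarrow> c *\<^sub>C x \<in> D"
    and F: "bounded_clinear_on D F"
  obtains g where "bounded_clinear g" "\<And>x. x \<in> D \<Longrightarrow> g x = F x"
proof -
  have Fadd: "F (x + y) = F x + F y" if "x \<in> D" "y \<in> D" for x y
    using F that by (auto simp: bounded_clinear_on_def)
  have Fscale: "F (c *\<^sub>C x) = c *\<^sub>C F x" if "x \<in> D" for c x
    using F that by (auto simp: bounded_clinear_on_def)
  obtain M where M0: "\<forall>x\<in>D. norm (F x) \<le> M * norm x"
    using F unfolding bounded_clinear_on_def by blast
  have M: "norm (F x) \<le> \<bar>M\<bar> * norm x" if "x \<in> D" for x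
    using M0 that by (meson abs_ge_self mult_right_mono norm_ge_zero order_trans)
  have minus: "(-1) *\<^sub>C x = - x" for x :: "'c::complex_banach"
    using scaleR_scaleC[of "-1" x] by simp
  have Lip: "dist (F x) (F y) \<le> \<bar>M\<bar> * dist x y" if "x \<in> D" "y \<in> D" for x y
  proof -
    have y: "- y \<in> D" "F (- y) = - F y"
      using scale[OF \<open>y \<in> D\<close>, of "-1"] Fscale[OF \<open>y \<in> D\<close>, of "-1"] by (simp_all add: minus)
    show ?thesis
      using M[OF add[OF \<open>x \<in> D\<close> y(1)]] Fadd[OF \<open>x \<in> D\<close> y(1)] by (simp add: y(2) dist_norm)
  qed
  have "uniformly_continuous_on D F"
    by (rule lipschitz_on_uniformly_continuous[where L = "\<bar>M\<bar>"]) (auto intro: lipschitz_onI Lip)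
  then obtain g where g: "uniformly_continuous_on (closure D) g" "\<And>x. x \<in> D \<Longrightarrow> F x = g x"
    by (rule uniformly_continuous_on_extension_on_closure) (rule that)
  then have cont: "continuous_on UNIV g"
    using dense uniformly_continuous_imp_continuous by metis
  have lim: "(\<lambda>n. g (u n)) \<longlonglongrightarrow> g x" if "u \<longlonglongrightarrow> x" for u x
    using cont that by (auto intro: continuous_on_tendsto_compose)
  have approx: "\<exists>u. (\<forall>n. u n \<in> D) \<and> u \<longlonglongrightarrow> x" for x
    using dense closure_sequential[of x D] by auto
  have gadd: "g (x + y) = g x + g y" for x y
  proof -
    obtain u v where u: "\<And>n. u n \<in> D" "u \<longlonglongrightarrow> x" and v: "\<And>n. v n \<in> D" "v \<longlonglongrightarrow> y"
      using approx by metis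
    have "(\<lambda>n. g (u n + v n)) \<longlonglongrightarrow> g (x + y)"
      by (intro lim tendsto_add u v)
    moreover have "g (u n + v n) = g (u n) + g (v n)" for n
      using Fadd[OF u(1) v(1)] add[OF u(1) v(1)] u(1) v(1) by (simp flip: g(2))
    ultimately have "(\<lambda>n. g (u n) + g (v n)) \<longlonglongrightarrow> g (x + y)"
      by simp
    then show ?thesis
      using LIMSEQ_unique tendsto_add[OF lim[OF u(2)] lim[OF v(2)]] by blast
  qed
  have gscale: "g (c *\<^sub>C x) = c *\<^sub>C g x" for c x
  proof -
    obtain u where u: "\<And>n. u n \<in> D" "u \<longlonglongrightarrow> x"
      using approx by metis
    have "(\<lambda>n. g (c *\<^sub>C u n)) \<longlonglongrightarrow> g (c *\<^sub>C x)"
      by (intro lim bounded_linear.tendsto[OF bounded_linear_scaleC] u)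
    moreover have "g (c *\<^sub>C u n) = c *\<^sub>C g (u n)" for n
      using Fscale[OF u(1)] scale[OF u(1)] u(1) by (simp flip: g(2))
    ultimately have "(\<lambda>n. c *\<^sub>C g (u n)) \<longlonglongrightarrow> g (c *\<^sub>C x)"
      by simp
    then show ?thesis
      using LIMSEQ_unique bounded_linear.tendsto[OF bounded_linear_scaleC lim[OF u(2)]] by blast
  qed
  have bound: "norm (g x) \<le> norm x * \<bar>M\<bar>" for x
  proof -
    obtain u where u: "\<And>n. u n \<in> D" "u \<longlonglongrightarrow> x"
      using approx by metis
    have "norm (g (u n)) \<le> norm (u n) * \<bar>M\<bar>" for n
      using M[OF u(1)] g(2)[OF u(1)] by (simp add: mult.commute)
    then show ?thesis
      by (intro LIMSEQ_le[OF tendsto_norm[OF lim[OF u(2)]] tendsto_mult_right[OF tendsto_norm[OF u(2)]]])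
        auto
  qed
  have "g (r *\<^sub>R x) = r *\<^sub>R g x" for r x
    by (simp add: scaleR_scaleC gscale)
  then have "bounded_linear g"
    using gadd bound by (intro bounded_linear_intro)
  then show ?thesis
    using that gscale g(2) by (auto simp: bounded_clinear_def)
qed


section \<open>Orbits of bounded semigroups\<close>

lemma bounded_semigroup_norm_bound:
  assumes "C0_semigroup T" "bounded_semigroup T"
  obtains M where "M > 0" "\<And>t x. t \<ge> 0 \<Longrightarrow> norm (T t x) \<le> M * norm x"
proof -
  obtain M where M: "\<And>t. t \<ge> 0 \<Longrightarrow> onorm (T t) \<le> M"
    using assms(2) by (auto simp: bounded_semigroup_def)
  have "norm (T t x) \<le> max M 1 * norm x" if "t \<ge> 0" for t x
  proof -
    have "bounded_linear (T t)"
      using assms(1) that by (simp add: C0_semigroup_def bounded_clinear_def)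
    then have "norm (T t x) \<le> onorm (T t) * norm x"
      by (rule onorm)
    also have "\<dots> \<le> max M 1 * norm x"
      using M[OF that] by (intro mult_right_mono) auto
    finally show ?thesis .
  qed
  then show ?thesis
    using that[of "max M 1"] by simp
qed

text \<open>For \<open>s \<le> t\<close> the increment is \<open>T(s) (T(t - s) x - x)\<close>, so the uniform bound reduces
  continuity everywhere, from both sides, to right continuity at \<open>0\<close>.\<close>

lemma bounded_semigroup_orbit_continuous:
  assumes T: "C0_semigroup T" and b: "bounded_semigroup T"
  shows "continuous_on {0..} (\<lambda>t. T t x)"
proof -
  obtain M where M: "M > 0" "\<And>t x. t \<ge> 0 \<Longrightarrow> norm (T t x) \<le> M * norm x"
    using bounded_semigroup_norm_bound[OF T b] by blast
  have lin: "bounded_linear (T t)" if "t \<ge> 0" for t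
    using T that by (simp add: C0_semigroup_def bounded_clinear_def)
  have sg: "T (s + t) x = T s (T t x)" if "s \<ge> 0" "t \<ge> 0" for s t
    using T that by (simp add: C0_semigroup_def)
  have lim0: "((\<lambda>t. T t x) \<longlongrightarrow> x) (at_right 0)"
    using T by (simp add: C0_semigroup_def)
  have incr: "norm (T t x - T s x) \<le> M * norm (T (t - s) x - x)" if "0 \<le> s" "s \<le> t" for s t
  proof -
    have "T t x - T s x = T s (T (t - s) x - x)"
      using sg[of s "t - s"] that linear_diff[OF bounded_linear.linear[OF lin[of s]]] by simp
    then show ?thesis
      using M(2)[OF that(1)] by simp
  qed
  show ?thesis
    unfolding continuous_on_iff
  proof (intro ballI allI impI)
    fix s e :: real assume s: "s \<in> {0..}" and e: "e > 0"
    have "eventually (\<lambda>t. dist (T t x) x < e / M) (at_right 0)"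
      using lim0 e M(1) by (intro tendstoD) auto
    then obtain d where d: "d > 0" "\<And>r. 0 < r \<Longrightarrow> r < d \<Longrightarrow> dist (T r x) x < e / M"
      by (auto simp: eventually_at_right_field)
    have "dist (T t x) (T s x) < e" if t: "t \<in> {0..}" "dist t s < d" for t
    proof (cases "t = s")
      case False
      have "M * norm (T \<bar>t - s\<bar> x - x) < e"
        using d(2)[of "\<bar>t - s\<bar>"] False t M(1) by (simp add: dist_norm field_simps)
      then show ?thesis
        using incr[of s t] incr[of t s] s t by (cases "s \<le> t") (auto simp: dist_norm norm_minus_commute)
    qed (use e in simp)
    then show "\<exists>d>0. \<forall>t\<in>{0..}. dist t s < d \<longrightarrow> dist (T t x) (T s x) < e"
      using d(1) by blast
  qed
qed

lemma bounded_semigroup_jointly_continuous: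
  assumes T: "C0_semigroup T" "bounded_semigroup T"
    and a: "continuous_on X a" "\<And>s. s \<in> X \<Longrightarrow> a s \<ge> 0" and f: "continuous_on X f"
  shows "continuous_on X (\<lambda>s. T (a s) (f s))"
  unfolding continuous_on_def
proof
  fix p assume p: "p \<in> X"
  obtain M where M: "M > 0" "\<And>t x. t \<ge> 0 \<Longrightarrow> norm (T t x) \<le> M * norm x"
    using bounded_semigroup_norm_bound[OF T] by blast
  have ev: "\<forall>\<^sub>F s in at p within X. s \<in> X"
    by (simp add: eventually_at_filter)
  have "continuous_on X (\<lambda>s. T (a s) (f p))"
    by (rule continuous_on_compose2[OF bounded_semigroup_orbit_continuous[OF T] a(1)])
      (use a(2) in auto)
  then have orbit: "((\<lambda>s. T (a s) (f p)) \<longlongrightarrow> T (a p) (f p)) (at p within X)"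
    using p by (simp add: continuous_on_def)
  have "(f \<longlongrightarrow> f p) (at p within X)"
    using f p by (simp add: continuous_on_def)
  then have null: "((\<lambda>s. M * norm (f s - f p)) \<longlongrightarrow> 0) (at p within X)"
    by (auto intro!: tendsto_eq_intros simp: Lim_null[symmetric])
  have "((\<lambda>s. T (a s) (f s) - T (a s) (f p)) \<longlongrightarrow> 0) (at p within X)"
  proof (rule tendsto_0_le[OF null, where K = 1])
    show "\<forall>\<^sub>F s in at p within X.
        norm (T (a s) (f s) - T (a s) (f p)) \<le> norm (M * norm (f s - f p)) * 1"
      using ev
    proof eventually_elim
      case (elim s)
      have "bounded_linear (T (a s))"
        using T(1) a(2)[OF elim] by (simp add: C0_semigroup_def bounded_clinear_def)
      then have "T (a s) (f s) - T (a s) (f p) = T (a s) (f s - f p)"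
        by (simp add: linear_diff bounded_linear.linear)
      then show ?case
        using M a(2)[OF elim] by (simp add: abs_mult)
    qed
  qed
  from tendsto_add[OF this orbit]
  show "((\<lambda>s. T (a s) (f s)) \<longlongrightarrow> T (a p) (f p)) (at p within X)"
    by simp
qed

text \<open>A continuous source enters a mild solution to first order only through its initial value.\<close>

lemma mild_solution_source_quotient:
  assumes T: "C0_semigroup T" "bounded_semigroup T" and f: "continuous_on {0..} f"
  shows "((\<lambda>h. integral {0..h} (\<lambda>s. T (h - s) (f s)) /\<^sub>R h) \<longlongrightarrow> f 0) (at_right 0)"
proof (rule tendstoI)
  fix e :: real assume e: "e > 0"
  obtain M where M: "M > 0" "\<And>t x. t \<ge> 0 \<Longrightarrow> norm (T t x) \<le> M * norm x"
    using bounded_semigroup_norm_bound[OF T] by blast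
  have T0: "T 0 x = x" for x
    using T(1) by (simp add: C0_semigroup_def)
  \<comment> \<open>Chosen so that \<open>M * e1\<close>, from the source, and \<open>e1\<close>, from the orbit, add up to \<open>e / 2\<close>.\<close>
  define e1 where "e1 = e / 2 / (M + 1)"
  have e1: "e1 > 0" "M * e1 + e1 < e"
  proof -
    show "e1 > 0"
      using e M(1) by (simp add: e1_def)
    have "M + 1 \<noteq> 0"
      using M(1) by simp
    then have "(M + 1) * e1 = e / 2"
      unfolding e1_def by (subst times_divide_eq_right) (rule nonzero_mult_div_cancel_left)
    also have "(M + 1) * e1 = M * e1 + e1"
      by (simp add: algebra_simps)
    finally show "M * e1 + e1 < e"
      using e by simp
  qed
  obtain d1 where d1: "d1 > 0" "\<And>s. 0 \<le> s \<Longrightarrow> s < d1 \<Longrightarrow> norm (f s - f 0) < e1"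
    using f e1(1) unfolding continuous_on_iff by (force simp: dist_norm)
  obtain d2 where d2: "d2 > 0" "\<And>s. 0 \<le> s \<Longrightarrow> s < d2 \<Longrightarrow> norm (T s (f 0) - f 0) < e1"
    using bounded_semigroup_orbit_continuous[OF T, of "f 0"] e1(1)
    unfolding continuous_on_iff by (force simp: dist_norm T0)
  have "dist (integral {0..h} (\<lambda>s. T (h - s) (f s)) /\<^sub>R h) (f 0) < e"
    if h: "0 < h" "h < min d1 d2" for h
  proof -
    have pt: "norm (T (h - s) (f s) - f 0) \<le> M * e1 + e1" if s: "s \<in> {0..h}" for s
    proof -
      have "bounded_linear (T (h - s))"
        using T(1) s by (simp add: C0_semigroup_def bounded_clinear_def)
      then have "T (h - s) (f s) - f 0 = T (h - s) (f s - f 0) + (T (h - s) (f 0) - f 0)"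
        by (simp add: linear_diff bounded_linear.linear)
      moreover have "norm (T (h - s) (f s - f 0)) \<le> M * e1"
        using M(2)[of "h - s" "f s - f 0"] d1(2)[of s] s h M(1)
        by (smt (verit) atLeastAtMost_iff mult_left_mono)
      moreover have "norm (T (h - s) (f 0) - f 0) \<le> e1"
        using d2(2)[of "h - s"] s h by auto
      ultimately show ?thesis
        by (metis norm_triangle_mono)
    qed
    have cont: "continuous_on {0..h} (\<lambda>s. T (h - s) (f s))"
      by (rule bounded_semigroup_jointly_continuous[OF T])
        (auto intro!: continuous_intros continuous_on_subset[OF f])
    have "integral {0..h} (\<lambda>s. T (h - s) (f s) - f 0)
        = integral {0..h} (\<lambda>s. T (h - s) (f s)) - h *\<^sub>R f 0"
      using h(1) by (subst integral_diff) (auto intro: integrable_continuous_real[OF cont])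
    then have "integral {0..h} (\<lambda>s. T (h - s) (f s)) /\<^sub>R h - f 0
        = integral {0..h} (\<lambda>s. T (h - s) (f s) - f 0) /\<^sub>R h"
      using h(1) by (simp add: scaleR_diff_right)
    moreover have "norm (integral {0..h} (\<lambda>s. T (h - s) (f s) - f 0)) \<le> (M * e1 + e1) * (h - 0)"
      using h(1) pt by (intro integral_bound continuous_intros cont) auto
    ultimately have "norm (integral {0..h} (\<lambda>s. T (h - s) (f s)) /\<^sub>R h - f 0) \<le> M * e1 + e1"
      using h(1) by (simp add: divide_simps mult.commute)
    then show ?thesis
      using e1(2) by (simp add: dist_norm)
  qed
  then show "\<forall>\<^sub>F h in at_right 0. dist (integral {0..h} (\<lambda>s. T (h - s) (f s)) /\<^sub>R h) (f 0) < e"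
    unfolding eventually_at_right_field using d1(1) d2(1)
    by (intro exI[of _ "min d1 d2"]) auto
qed


section \<open>Isometric groups\<close>

lemma isometric_group_increment:
  assumes "isometric_C0_group T"
  shows "norm (T t x - T s x) = norm (T (t - s) x - x)"
proof -
  have "bounded_linear (T s)"
    using assms by (simp add: isometric_C0_group_def bounded_clinear_def)
  moreover have "T (s + (t - s)) x = T s (T (t - s) x)"
    using assms unfolding isometric_C0_group_def by blast
  ultimately have "T t x - T s x = T s (T (t - s) x - x)"
    by (simp add: linear_diff bounded_linear.linear)
  then show ?thesis
    using assms by (simp add: isometric_C0_group_def)
qed

lemma isometric_group_orbit_uniformly_continuous:
  assumes T: "isometric_C0_group T"
  shows "uniformly_continuous_on UNIV (\<lambda>t. T t x)"
  unfolding uniformly_continuous_on_def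
proof (intro allI impI)
  fix e :: real assume e: "e > 0"
  have "((\<lambda>t. T t x) \<longlongrightarrow> x) (at 0)" and T0: "T 0 x = x"
    using T by (auto simp: isometric_C0_group_def)
  then obtain d where d: "d > 0" "\<And>t. t \<noteq> 0 \<Longrightarrow> \<bar>t\<bar> < d \<Longrightarrow> norm (T t x - x) < e"
    using e unfolding LIM_def by (auto simp: dist_norm)
  then have "norm (T t x - x) < e" if "\<bar>t\<bar> < d" for t
    using that e T0 by (cases "t = 0") auto
  with d(1) show "\<exists>d>0. \<forall>s\<in>UNIV. \<forall>t\<in>UNIV. dist t s < d \<longrightarrow> dist (T t x) (T s x) < e"
    by (auto simp: dist_norm isometric_group_increment[OF T])
qed

lemma isometric_group_orbit_continuous:
  "isometric_C0_group T \<Longrightarrow> continuous_on X (\<lambda>t. T t x)"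
  using isometric_group_orbit_uniformly_continuous uniformly_continuous_imp_continuous
    continuous_on_subset by blast

lemma domain_iff:
  assumes "generates_isometric_C0_group D G T"
  shows "x \<in> D \<longleftrightarrow> (\<exists>y. ((\<lambda>h. (T h x - x) /\<^sub>R h) \<longlongrightarrow> y) (at 0))"
  using assms by (auto simp: generates_isometric_C0_group_def)

lemma domain_add:
  assumes G: "generates_isometric_C0_group D G T" and "x \<in> D" "y \<in> D"
  shows "x + y \<in> D"
proof -
  have lin: "bounded_linear (T h)" for h
    using G by (simp add: generates_isometric_C0_group_def isometric_C0_group_def bounded_clinear_def)
  obtain x' y' where "((\<lambda>h. (T h x - x) /\<^sub>R h) \<longlongrightarrow> x') (at 0)"
      "((\<lambda>h. (T h y - y) /\<^sub>R h) \<longlongrightarrow> y') (at 0)"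
    using assms domain_iff[OF G] by blast
  from tendsto_add[OF this]
  have "((\<lambda>h. (T h (x + y) - (x + y)) /\<^sub>R h) \<longlongrightarrow> x' + y') (at 0)"
    by (simp add: linear_add[OF bounded_linear.linear[OF lin]] algebra_simps)
  then show ?thesis
    using domain_iff[OF G] by blast
qed

text \<open>Scalar multiplications and the operators of the group itself are instances.\<close>

lemma domain_invariant:
  assumes G: "generates_isometric_C0_group D G T" and V: "bounded_linear V"
    and comm: "\<And>h x. T h (V x) = V (T h x)" and x: "x \<in> D"
  shows "V x \<in> D"
proof -
  obtain x' where "((\<lambda>h. (T h x - x) /\<^sub>R h) \<longlongrightarrow> x') (at 0)"
    using x domain_iff[OF G] by blast
  from bounded_linear.tendsto[OF V this]
  have "((\<lambda>h. (T h (V x) - V x) /\<^sub>R h) \<longlongrightarrow> V x') (at 0)"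
    by (simp add: linear_diff linear_scale bounded_linear.linear[OF V] comm)
  then show ?thesis
    using domain_iff[OF G] by blast
qed

lemma has_vector_derivative_quotient:
  assumes "(f has_vector_derivative d) (at x)"
  shows "((\<lambda>h. (f (x + h) - f x) /\<^sub>R h) \<longlongrightarrow> d) (at 0)"
proof -
  have "((\<lambda>h. norm (f (x + h) - f x - h *\<^sub>R d) / norm h) \<longlongrightarrow> 0) (at 0)"
    using assms by (simp add: has_vector_derivative_def has_derivative_at)
  then have "((\<lambda>h. norm ((f (x + h) - f x) /\<^sub>R h - d)) \<longlongrightarrow> 0) (at 0)"
  proof (rule Lim_transform_eventually)
    show "\<forall>\<^sub>F h in at 0. norm (f (x + h) - f x - h *\<^sub>R d) / norm h = norm ((f (x + h) - f x) /\<^sub>R h - d)"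
      unfolding eventually_at_filter
    proof (intro always_eventually allI impI)
      fix h :: real assume "h \<noteq> 0"
      then have "(f (x + h) - f x) /\<^sub>R h - d = (f (x + h) - f x - h *\<^sub>R d) /\<^sub>R h"
        by (simp add: scaleR_diff_right)
      then show "norm (f (x + h) - f x - h *\<^sub>R d) / norm h = norm ((f (x + h) - f x) /\<^sub>R h - d)"
        by (simp add: divide_inverse mult.commute)
    qed
  qed
  then show ?thesis
    using Lim_null tendsto_norm_zero_iff by blast
qed

text \<open>The averages of an orbit over \<open>[0, a]\<close> converge to its starting point as \<open>a\<close> tends to
  \<open>0\<close>, and they lie in the domain: with a primitive \<open>\<Phi>\<close> of the orbit, the group moves the
  integral \<open>\<Phi>(a) - \<Phi>(0)\<close> to \<open>\<Phi>(a + h) - \<Phi>(h)\<close>, which is differentiable in \<open>h\<close>.\<close>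

lemma domain_dense:
  assumes G: "generates_isometric_C0_group D G T"
  shows "closure D = UNIV"
proof -
  have T: "isometric_C0_group T"
    using G by (simp add: generates_isometric_C0_group_def)
  have lin: "bounded_linear (T h)" for h
    using T by (simp add: isometric_C0_group_def bounded_clinear_def)
  have grp: "T (s + t) x = T s (T t x)" for s t x
    using T by (simp add: isometric_C0_group_def)
  have "x \<in> closure D" for x
  proof -
    \<comment> \<open>The base point lies left of \<open>0\<close> so that \<open>\<Phi>\<close> has a two-sided derivative at \<open>0\<close>.\<close>
    define \<Phi> where "\<Phi> u = integral {-1..u} (\<lambda>t. T t x)" for u
    have cont: "continuous_on X (\<lambda>t. T t x)" for X
      by (rule isometric_group_orbit_continuous[OF T])
    have int: "(\<lambda>t. T t x) integrable_on {a..b}" for a b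
      by (rule integrable_continuous_real[OF cont])
    have \<Phi>': "(\<Phi> has_vector_derivative T u x) (at u)" if "u > -1" for u
    proof -
      have "(\<Phi> has_vector_derivative T u x) (at u within {-1..u + 1})"
        unfolding \<Phi>_def using that by (intro integral_has_vector_derivative cont) auto
      moreover have "at u within {-1..u + 1} = at u"
        using that by (intro at_within_interior) auto
      ultimately show ?thesis by simp
    qed
    have quotient: "((\<lambda>h. (\<Phi> (u + h) - \<Phi> u) /\<^sub>R h) \<longlongrightarrow> T u x) (at 0)" if "u > -1" for u
      by (rule has_vector_derivative_quotient[OF \<Phi>'[OF that]])
    have \<Phi>_diff: "integral {a..b} (\<lambda>t. T t x) = \<Phi> b - \<Phi> a" if "-1 \<le> a" "a \<le> b" for a b
      using Henstock_Kurzweil_Integration.integral_combine[OF that int] by (simp add: \<Phi>_def algebra_simps)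
    have mem: "(\<Phi> a - \<Phi> 0) /\<^sub>R a \<in> D" if a: "a > 0" for a
    proof -
      have shift: "T h (\<Phi> a - \<Phi> 0) = \<Phi> (a + h) - \<Phi> (0 + h)" if h: "\<bar>h\<bar> < 1" for h
      proof -
        have "T h (\<Phi> a - \<Phi> 0) = T h (integral {0..a} (\<lambda>t. T t x))"
          using a by (simp add: \<Phi>_diff)
        also have "\<dots> = integral {0..a} (\<lambda>t. T h (T t x))"
          using integral_linear[OF int lin] by (simp add: o_def)
        also have "\<dots> = integral {0..a} (\<lambda>t. T (t + h) x)"
          by (simp add: add.commute flip: grp)
        also have "\<dots> = integral {h..a + h} (\<lambda>t. T t x)"
          using integral_shift_real_ivl[where a = h and b = "a + h" and c = h and f = "\<lambda>t. T t x"] by simp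
        also have "\<dots> = \<Phi> (a + h) - \<Phi> h"
          using a h by (intro \<Phi>_diff) auto
        finally show ?thesis by simp
      qed
      have "((\<lambda>h. (\<Phi> (a + h) - \<Phi> a) /\<^sub>R h - (\<Phi> (0 + h) - \<Phi> 0) /\<^sub>R h) \<longlongrightarrow> T a x - T 0 x) (at 0)"
        using a by (intro tendsto_diff quotient) auto
      moreover have "\<forall>\<^sub>F h in at 0. (\<Phi> (a + h) - \<Phi> a) /\<^sub>R h - (\<Phi> (0 + h) - \<Phi> 0) /\<^sub>R h
          = (T h (\<Phi> a - \<Phi> 0) - (\<Phi> a - \<Phi> 0)) /\<^sub>R h"
        unfolding eventually_at
      proof (intro exI[of _ 1] conjI ballI impI)
        fix h :: real assume "h \<noteq> 0 \<and> dist h 0 < 1"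
        then have "T h (\<Phi> a - \<Phi> 0) = \<Phi> (a + h) - \<Phi> (0 + h)"
          by (intro shift) simp
        then show "(\<Phi> (a + h) - \<Phi> a) /\<^sub>R h - (\<Phi> (0 + h) - \<Phi> 0) /\<^sub>R h
            = (T h (\<Phi> a - \<Phi> 0) - (\<Phi> a - \<Phi> 0)) /\<^sub>R h"
          by (simp only: flip: scaleR_diff_right) (simp add: algebra_simps)
      qed simp
      ultimately have "((\<lambda>h. (T h (\<Phi> a - \<Phi> 0) - (\<Phi> a - \<Phi> 0)) /\<^sub>R h) \<longlongrightarrow> T a x - T 0 x) (at 0)"
        by (rule Lim_transform_eventually)
      then have "\<Phi> a - \<Phi> 0 \<in> D"
        using domain_iff[OF G] by blast
      then show ?thesis
        by (rule domain_invariant[OF G bounded_linear_scaleR_right[of "inverse a"], rotated])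
          (simp add: linear_scale bounded_linear.linear[OF lin])
    qed
    have lim: "((\<lambda>h. (\<Phi> (0 + h) - \<Phi> 0) /\<^sub>R h) \<longlongrightarrow> T 0 x) (at_right 0)"
      by (rule tendsto_mono[OF _ quotient]) (auto simp: at_le)
    have "T 0 x \<in> closure D"
    proof (rule Lim_in_closed_set[OF closed_closure _ _ lim])
      show "\<forall>\<^sub>F h in at_right 0. (\<Phi> (0 + h) - \<Phi> 0) /\<^sub>R h \<in> closure D"
        unfolding eventually_at_right_field
        using mem closure_subset by (intro exI[of _ 1]) auto
    qed simp
    then show ?thesis
      using T by (simp add: isometric_C0_group_def)
  qed
  then show ?thesis by auto
qed


section \<open>The integral of a conform operator\<close>

text \<open>Since \<open>T(h)\<close> turns the integrand \<open>T(t) \<Delta> T\<^sub>S(-t) w\<close> into \<open>T(t + h) \<Delta> T\<^sub>S(-(t + h)) T\<^sub>S(h) w\<close>,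
  it turns the integral for \<open>w\<close> into the integral for \<open>T\<^sub>S(h) w\<close> with the part over \<open>[0, h]\<close>
  removed; reversing time in that part makes it the source term of the mild solution.\<close>

lemma conform_integral_orbit:
  fixes T :: "real \<Rightarrow> 'z::complex_banach \<Rightarrow> 'z" and TS :: "real \<Rightarrow> 'w::complex_banach \<Rightarrow> 'w"
  assumes T: "C0_semigroup T" "bounded_semigroup T" and TS: "isometric_C0_group TS"
    and \<Delta>: "bounded_linear \<Delta>"
    and lim_w: "((\<lambda>\<tau>. integral {0..\<tau>} (\<lambda>t. T t (\<Delta> (TS (- t) w)))) \<longlongrightarrow> z) at_top"
    and lim_hw: "((\<lambda>\<tau>. integral {0..\<tau>} (\<lambda>t. T t (\<Delta> (TS (- t) (TS h w))))) \<longlongrightarrow> z') at_top"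
    and h: "h \<ge> 0"
  shows "mild_solution T (\<lambda>s. \<Delta> (TS s w)) z h = z'"
proof -
  define g where "g v t = T t (\<Delta> (TS (- t) v))" for v t
  have grp: "TS (s + t) v = TS s (TS t v)" for s t v
    using TS by (simp add: isometric_C0_group_def)
  have lin: "bounded_linear (T h)"
    using T(1) h by (simp add: C0_semigroup_def bounded_clinear_def)
  have int: "g v integrable_on {a..b}" if "a \<ge> 0" for v a b
    unfolding g_def
    by (intro integrable_continuous_real bounded_semigroup_jointly_continuous[OF T] continuous_intros
        bounded_linear.continuous_on[OF \<Delta>]
        continuous_on_compose2[OF isometric_group_orbit_continuous[OF TS, of UNIV]])
      (use that in auto)
  have shift: "T h (integral {0..\<tau>} (g w))
      = integral {0..\<tau> + h} (g (TS h w)) - integral {0..h} (g (TS h w))" if \<tau>: "\<tau> \<ge> 0" for \<tau>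
  proof -
    have "T h (integral {0..\<tau>} (g w)) = integral {0..\<tau>} (\<lambda>t. T h (g w t))"
      using integral_linear[OF int lin] by (simp add: o_def)
    also have "\<dots> = integral {0..\<tau>} (\<lambda>t. g (TS h w) (t + h))"
    proof (rule integral_cong)
      fix t assume "t \<in> {0..\<tau>}"
      then have "T h (g w t) = T (t + h) (\<Delta> (TS (- t) w))"
        using T(1) h by (simp add: C0_semigroup_def g_def add.commute)
      also have "TS (- t) w = TS (- (t + h)) (TS h w)"
        by (simp flip: grp)
      finally show "T h (g w t) = g (TS h w) (t + h)"
        by (simp add: g_def)
    qed
    also have "\<dots> = integral {h..\<tau> + h} (g (TS h w))"
      using integral_shift_real_ivl[where a = h and b = "\<tau> + h" and c = h and f = "g (TS h w)"] by simp
    also have "\<dots> = integral {0..\<tau> + h} (g (TS h w)) - integral {0..h} (g (TS h w))"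
      using Henstock_Kurzweil_Integration.integral_combine[of 0 h "\<tau> + h" "g (TS h w)"] int h \<tau> by (simp add: algebra_simps)
    finally show ?thesis .
  qed
  have "((\<lambda>\<tau>. T h (integral {0..\<tau>} (g w))) \<longlongrightarrow> T h z) at_top"
    by (rule bounded_linear.tendsto[OF lin lim_w[folded g_def]])
  moreover have "\<forall>\<^sub>F \<tau> in at_top. T h (integral {0..\<tau>} (g w))
      = integral {0..\<tau> + h} (g (TS h w)) - integral {0..h} (g (TS h w))"
    using shift by (auto simp: eventually_at_top_linorder)
  ultimately have "((\<lambda>\<tau>. integral {0..\<tau> + h} (g (TS h w)) - integral {0..h} (g (TS h w)))
      \<longlongrightarrow> T h z) at_top"
    by (rule Lim_transform_eventually)
  moreover have "((\<lambda>\<tau>. integral {0..\<tau> + h} (g (TS h w)) - integral {0..h} (g (TS h w)))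
      \<longlongrightarrow> z' - integral {0..h} (g (TS h w))) at_top"
  proof (intro tendsto_intros)
    have "filterlim (\<lambda>\<tau>. \<tau> + h) at_top at_top"
      using filterlim_tendsto_add_at_top[OF tendsto_const[of h] filterlim_ident]
      by (simp add: add.commute)
    then show "((\<lambda>\<tau>. integral {0..\<tau> + h} (g (TS h w))) \<longlongrightarrow> z') at_top"
      by (rule filterlim_compose[OF lim_hw[folded g_def]])
  qed
  ultimately have "T h z = z' - integral {0..h} (g (TS h w))"
    by (rule tendsto_unique[OF trivial_limit_at_top_linorder])
  moreover have "integral {0..h} (g (TS h w)) = integral {0..h} (\<lambda>s. T (h - s) (\<Delta> (TS s w)))"
  proof -
    \<comment> \<open>Substitution of \<open>h - t\<close> for \<open>t\<close>.\<close>
    have "((\<lambda>t. g (TS h w) (- 1 *\<^sub>R t + h)) has_integral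
        (1 / \<bar>- 1\<bar> ^ DIM(real)) *\<^sub>R integral {0..h} (g (TS h w)))
        ((\<lambda>t. (1 / - 1) *\<^sub>R t + - ((1 / - 1) *\<^sub>R h)) ` cbox 0 h)"
      by (rule has_integral_affinity) (use int in \<open>auto intro: integrable_integral\<close>)
    moreover have "(\<lambda>t. (1 / - 1) *\<^sub>R t + - ((1 / - 1) *\<^sub>R h)) ` cbox 0 h = {0..h}"
      using image_diff_atLeastAtMost[of h 0 h] by simp
    moreover have "(\<lambda>t. g (TS h w) (- 1 *\<^sub>R t + h)) = (\<lambda>s. T (h - s) (\<Delta> (TS s w)))"
      by (simp add: fun_eq_iff g_def flip: grp)
    ultimately have "((\<lambda>s. T (h - s) (\<Delta> (TS s w))) has_integral integral {0..h} (g (TS h w))) {0..h}"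
      by simp
    then show ?thesis
      by (simp add: integral_unique)
  qed
  ultimately show ?thesis
    by (simp add: mild_solution_def)
qed


section \<open>The regulator equations\<close>

text \<open>The two sides of the invariance hypothesis are differentiated at time \<open>0\<close>: the right side has
  derivative \<open>\<Pi> S w\<close>, the source term on the left contributes \<open>\<Delta> w\<close>, so the orbit of \<open>\<Pi> w\<close> must be
  differentiable with the difference as its derivative.\<close>

lemma invariant_graph_generator_equation:
  assumes T: "generates_C0_semigroup D G T" "bounded_semigroup T"
    and TS: "generates_isometric_C0_group DS S TS"
    and \<Delta>: "bounded_linear \<Delta>" and Pi_op: "bounded_linear Pi_op" and w: "w \<in> DS"
    and inv: "\<And>h. h \<ge> 0 \<Longrightarrow> mild_solution T (\<lambda>s. \<Delta> (TS s w)) (Pi_op w) h = Pi_op (TS h w)"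
  shows "Pi_op w \<in> D" "G (Pi_op w) = Pi_op (S w) - \<Delta> w"
proof -
  have T0: "C0_semigroup T"
    using T(1) by (simp add: generates_C0_semigroup_def)
  have iso: "isometric_C0_group TS"
    using TS by (simp add: generates_isometric_C0_group_def)
  have "((\<lambda>h. (TS h w - w) /\<^sub>R h) \<longlongrightarrow> S w) (at 0)"
    using TS w by (auto simp: generates_isometric_C0_group_def)
  then have "((\<lambda>h. (TS h w - w) /\<^sub>R h) \<longlongrightarrow> S w) (at_right 0)"
    by (rule tendsto_mono[rotated]) (auto simp: at_le)
  then have "((\<lambda>h. Pi_op ((TS h w - w) /\<^sub>R h)) \<longlongrightarrow> Pi_op (S w)) (at_right 0)"
    by (rule bounded_linear.tendsto[OF Pi_op])
  moreover have "((\<lambda>h. integral {0..h} (\<lambda>s. T (h - s) (\<Delta> (TS s w))) /\<^sub>R h)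
      \<longlongrightarrow> \<Delta> (TS 0 w)) (at_right 0)"
    by (intro mild_solution_source_quotient[OF T0 T(2)] bounded_linear.continuous_on[OF \<Delta>]
        isometric_group_orbit_continuous[OF iso])
  ultimately have "((\<lambda>h. Pi_op ((TS h w - w) /\<^sub>R h)
      - integral {0..h} (\<lambda>s. T (h - s) (\<Delta> (TS s w))) /\<^sub>R h) \<longlongrightarrow> Pi_op (S w) - \<Delta> w) (at_right 0)"
    using iso by (auto simp: isometric_C0_group_def intro: tendsto_diff)
  moreover have "\<forall>\<^sub>F h in at_right 0. Pi_op ((TS h w - w) /\<^sub>R h)
      - integral {0..h} (\<lambda>s. T (h - s) (\<Delta> (TS s w))) /\<^sub>R h = (T h (Pi_op w) - Pi_op w) /\<^sub>R h"
    unfolding eventually_at_right_field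
  proof (intro exI[of _ 1] conjI allI impI)
    fix h :: real assume "0 < h" "h < 1"
    then have "Pi_op (TS h w) = T h (Pi_op w) + integral {0..h} (\<lambda>s. T (h - s) (\<Delta> (TS s w)))"
      using inv[of h] by (simp add: mild_solution_def)
    then show "Pi_op ((TS h w - w) /\<^sub>R h)
      - integral {0..h} (\<lambda>s. T (h - s) (\<Delta> (TS s w))) /\<^sub>R h = (T h (Pi_op w) - Pi_op w) /\<^sub>R h"
      by (simp add: linear_diff linear_scale bounded_linear.linear[OF Pi_op] algebra_simps)
  qed simp
  ultimately have "((\<lambda>h. (T h (Pi_op w) - Pi_op w) /\<^sub>R h) \<longlongrightarrow> Pi_op (S w) - \<Delta> w) (at_right 0)"
    by (rule Lim_transform_eventually)
  then show "Pi_op w \<in> D" "G (Pi_op w) = Pi_op (S w) - \<Delta> w"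
    using T(1) by (auto simp: generates_C0_semigroup_def)
qed

text \<open>Boundedness and uniform continuity of the signal are automatic for an isometric group, so
  only its decay has to be known.\<close>

lemma admissible_vanishing_signal:
  fixes R :: "'w::complex_banach \<Rightarrow> 'y::complex_banach"
  assumes adm: "generates_admissible_signals TS TYPE('y)" and TS: "isometric_C0_group TS"
    and R: "bounded_clinear R" and lim: "((\<lambda>t. R (TS t w)) \<longlongrightarrow> 0) at_top"
  shows "R w = 0"
proof -
  have Rl: "bounded_linear R"
    by (rule bounded_clinear_imp_bounded_linear[OF R])
  have "norm (R (TS t w)) \<le> onorm R * norm w" for t
    using onorm[OF Rl, of "TS t w"] TS by (simp add: isometric_C0_group_def)
  then have "bounded (range (\<lambda>t. R (TS t w)))"
    by (auto simp: bounded_iff)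
  moreover have "uniformly_continuous_on UNIV (\<lambda>t. R (TS t w))"
    by (rule bounded_linear.uniformly_continuous_on[OF Rl isometric_group_orbit_uniformly_continuous[OF TS]])
  ultimately have "(\<lambda>t. R (TS t w)) \<in> C0_plus"
    using lim by (simp add: C0_plus_def)
  then show ?thesis
    using adm R by (auto simp: generates_admissible_signals_def)
qed

theorem theorem4p7:
  fixes A :: "'z::complex_banach \<Rightarrow> 'z" and DA :: "'z set" and TA :: "real \<Rightarrow> 'z \<Rightarrow> 'z"
    and B :: "'u::complex_banach \<Rightarrow> 'z" and C :: "'z \<Rightarrow> 'y::complex_banach"
    and S :: "'w::complex_banach \<Rightarrow> 'w" and DS :: "'w set" and TS :: "real \<Rightarrow> 'w \<Rightarrow> 'w"
    and P :: "'w \<Rightarrow> 'z" and Q :: "'w \<Rightarrow> 'y"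
    and K :: "'z \<Rightarrow> 'u" and L :: "'w \<Rightarrow> 'u"
    and TABK :: "real \<Rightarrow> 'z \<Rightarrow> 'z"
  assumes "generates_C0_semigroup DA A TA"
    and "bounded_clinear B" and "bounded_clinear C"
    and "generates_isometric_C0_group DS S TS"
    and "bounded_clinear P" and "bounded_clinear Q"
    and "generates_admissible_signals TS TYPE('y)"
    and "bounded_clinear K" and "bounded_clinear L"
    and "solves_SFRP DA A B C DS TS P Q K L TABK"
    and "conform TABK DS TS (\<lambda>w. B (L w) + P w)"
  shows "\<exists>(Pi_op::'w \<Rightarrow> 'z) (Gamma_op::'w \<Rightarrow> 'u).
    bounded_clinear Pi_op \<and> bounded_clinear Gamma_op \<and>
    Pi_op ` DS \<subseteq> DA \<and>
    L = (\<lambda>w. Gamma_op w - K (Pi_op w)) \<and>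
    (\<forall>w\<in>DS. A (Pi_op w) + B (Gamma_op w) + P w = Pi_op (S w)) \<and>
    (\<forall>w. C (Pi_op w) = Q w)"
proof -
  define \<Delta> where "\<Delta> = (\<lambda>w. B (L w) + P w)"
  note B = assms(2) and C = assms(3) and TS = assms(4) and P = assms(5) and Q = assms(6)
    and K = assms(8) and L = assms(9)
  have iso: "isometric_C0_group TS"
    using TS by (simp add: generates_isometric_C0_group_def)
  have gen: "generates_C0_semigroup DA (\<lambda>z. A z + B (K z)) TABK"
    and bdd: "bounded_semigroup TABK"
    and track: "\<And>z0 w0. (tracking_error TABK TS \<Delta> C Q z0 w0 \<longlongrightarrow> 0) at_top"
    using assms(10) by (auto simp: solves_SFRP_def \<Delta>_def)
  have T: "C0_semigroup TABK"
    using gen by (simp add: generates_C0_semigroup_def)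
  have "bounded_clinear \<Delta>"
    unfolding \<Delta>_def by (intro bounded_clinear_add bounded_clinear_compose[OF B L] P)
  then have \<Delta>: "bounded_linear \<Delta>"
    by (rule bounded_clinear_imp_bounded_linear)
  obtain F where F: "bounded_clinear_on DS F" and
    limF: "\<And>w. w \<in> DS \<Longrightarrow>
      ((\<lambda>\<tau>. integral {0..\<tau>} (\<lambda>t. TABK t (\<Delta> (TS (- t) w)))) \<longlongrightarrow> F w) at_top"
    using assms(11) unfolding conform_def \<Delta>_def by blast
  have TS_clin: "TS h (c *\<^sub>C x) = c *\<^sub>C TS h x" for h c x
    using iso by (simp add: isometric_C0_group_def bounded_clinear_def)
  have scale: "c *\<^sub>C x \<in> DS" if "x \<in> DS" for c x
    using that
    by (intro domain_invariant[where V = "\<lambda>x. c *\<^sub>C x", OF TS] bounded_linear_scaleC TS_clin)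
  obtain Pi_op where Pi_op: "bounded_clinear Pi_op" and Pi_eq: "\<And>w. w \<in> DS \<Longrightarrow> Pi_op w = F w"
    using bounded_clinear_extension[OF domain_dense[OF TS] domain_add[OF TS] scale F] by blast
  have lin_Pi: "bounded_linear Pi_op"
    by (rule bounded_clinear_imp_bounded_linear[OF Pi_op])
  have TS_DS: "TS h w \<in> DS" if "w \<in> DS" for h w
  proof (rule domain_invariant[OF TS _ _ that])
    show "bounded_linear (TS h)"
      using iso by (simp add: isometric_C0_group_def bounded_clinear_def)
    show "TS k (TS h x) = TS h (TS k x)" for k x
      using iso by (metis add.commute isometric_C0_group_def)
  qed
  have graph: "mild_solution TABK (\<lambda>s. \<Delta> (TS s w)) (Pi_op w) h = Pi_op (TS h w)"
    if "w \<in> DS" "h \<ge> 0" for w h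
    by (rule conform_integral_orbit[OF T bdd iso \<Delta> _ _ that(2)])
      (use limF[OF that(1)] limF[OF TS_DS[OF that(1), of h]] that TS_DS in \<open>simp_all add: Pi_eq\<close>)
  have eq: "Pi_op w \<in> DA" "A (Pi_op w) + B (K (Pi_op w)) = Pi_op (S w) - \<Delta> w" if "w \<in> DS" for w
    using invariant_graph_generator_equation[OF gen bdd TS \<Delta> lin_Pi that graph[OF that]] by auto

  define R where "R = (\<lambda>w. C (Pi_op w) - Q w)"
  have R: "bounded_clinear R"
    unfolding R_def by (intro bounded_clinear_diff bounded_clinear_compose[OF C Pi_op] Q)
  have "R w = 0" if w: "w \<in> DS" for w
  proof (rule admissible_vanishing_signal[OF assms(7) iso R])
    have "\<forall>\<^sub>F t in at_top. tracking_error TABK TS \<Delta> C Q (Pi_op w) w t = R (TS t w)"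
      using eventually_ge_at_top[of 0]
      by eventually_elim (simp add: tracking_error_def graph[OF w] R_def)
    with track show "((\<lambda>t. R (TS t w)) \<longlongrightarrow> 0) at_top"
      by (rule Lim_transform_eventually)
  qed
  moreover have "continuous_on (closure DS) R"
    using bounded_clinear_imp_bounded_linear[OF R] by (rule linear_continuous_on)
  ultimately have R0: "R w = 0" for w
    using continuous_constant_on_closure[of DS R 0 w] domain_dense[OF TS] by auto

  have "bounded_clinear (\<lambda>w. L w + K (Pi_op w))"
    by (intro bounded_clinear_add L bounded_clinear_compose[OF K Pi_op])
  moreover have "A (Pi_op w) + B (L w + K (Pi_op w)) + P w = Pi_op (S w)" if "w \<in> DS" for w
  proof -
    have "B (L w + K (Pi_op w)) = B (L w) + B (K (Pi_op w))"
      by (rule linear_add[OF bounded_linear.linear[OF bounded_clinear_imp_bounded_linear[OF B]]])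
    then show ?thesis
      using eq(2)[OF that] by (simp add: \<Delta>_def algebra_simps)
  qed
  ultimately show ?thesis
    using Pi_op eq(1) R0
    by (intro exI[of _ Pi_op] exI[of _ "\<lambda>w. L w + K (Pi_op w)"]) (auto simp: R_def)
qed

end
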